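(* Let $M_3(\mathbb{C})=A\oplus B$ be a direct vector-space sum of two subalgebras with $\dim A=2$ and $\dim B=7$. Then there is a map $\varphi\colon M_3(\mathbb{C})\to M_3(\mathbb{C})$, which is an automorphism or an antiautomorphism of $M_3(\mathbb{C})$, such that $\varphi(B)=\mathrm{Span}\{e_{11},e_{12},e_{13},e_{22},e_{23},e_{32},e_{33}\}$ and $\varphi(A)=S$, where $S$ is one of the following subalgebras: (R1) $\mathrm{Span}\{e_{21},e_{31}\}$; (R2) $\mathrm{Span}\{e_{21},e_{31}+e_{23}\}$; (R3) $\mathrm{Span}\{e_{21}+e_{22},e_{31}\}$; (R4) $\mathrm{Span}\{e_{21}+e_{22}+e_{33},e_{31}+e_{32}\}$; (R5) $\mathrm{Span}\{e_{21}+e_{22}+e_{33},e_{31}\}$; (R6) $\mathrm{Span}\{e_{21}+e_{22},e_{31}+e_{32}\}$; (R7) $\mathrm{Span}\{e_{21}+e_{22},e_{31}+e_{33}\}$; (R8) $\mathrm{Span}\{e_{21}+(1-y)e_{22}+e_{23},\ e_{31}+e_{22}+e_{23}+ye_{33}\}$ for some $y\in\mathbb{C}$, $y\neq0$; (R9) $\mathrm{Span}\{e_{21}+e_{22}+e_{33},\ e_{31}+e_{32}+e_{23}+ye_{33}\}$ for some $y\in\mathbb{C}$, $y\neq0$; (R10) $\mathrm{Span}\left\{\begin{pmatrix}0&0&0\\1&d&1\\0&1/f&1\end{pmatrix},\begin{pmatrix}0&0&0\\0&1&f\\1&1&1+f(1-d)\end{pmatrix}\right\}$ for some $d,f\in\mathbb{C}$,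 $f\neq0$.
   Context: $M_3(\mathbb{C})$ is the algebra of $3\times3$ complex matrices, $e_{ij}$ are the matrix units, and $\mathrm{Span}$ means linear span over $\mathbb{C}$. A subalgebra is a $\mathbb{C}$-linear subspace closed under multiplication; it is not required to contain the identity matrix. An automorphism is a $\mathbb{C}$-algebra automorphism of $M_3(\mathbb{C})$; an antiautomorphism is the composition of an automorphism and the transpose map. The phrase "up to transpose and up to action of $\mathrm{Aut}(M_3(\mathbb{C}))$" is expressed in the claim by the existence of $\varphi$. *)

theory Defs
  imports "HOL-Analysis.Analysis"
begin

text \<open>
  The product \<open>*s\<close> would take its scalar from the type of rows, and \<open>*\<^sub>R\<close> gives
  only the real structure; the complex structure on square matrices is therefore set up here.
\<close>

definition scale_mat :: "complex \<Rightarrow> complex^'n^'n \<Rightarrow> complex^'n^'n"  (infixr "*\<^sub>m" 75)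
  where "c *\<^sub>m M = (\<chi> i j. c * M $ i $ j)"

interpretation cmat: vector_space "scale_mat :: complex \<Rightarrow> complex^'n^'n \<Rightarrow> complex^'n^'n"
  by unfold_locales (simp_all add: scale_mat_def vec_eq_iff algebra_simps)

text \<open>Subalgebras need not contain the identity matrix.\<close>

definition subalgebra :: "(complex^'n^'n) set \<Rightarrow> bool"
  where "subalgebra A \<longleftrightarrow> cmat.subspace A \<and> (\<forall>x\<in>A. \<forall>y\<in>A. x ** y \<in> A)"

definition direct_sum_decomp :: "(complex^'n^'n) set \<Rightarrow> (complex^'n^'n) set \<Rightarrow> bool"
  where "direct_sum_decomp A B \<longleftrightarrow>
    cmat.subspace A \<and> cmat.subspace B \<and> A \<inter> B = {0} \<and> {a + b | a b. a \<in> A \<and> b \<in> B} = UNIV"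

definition automorphism :: "(complex^'n^'n \<Rightarrow> complex^'n^'n) \<Rightarrow> bool"
  where "automorphism \<phi> \<longleftrightarrow>
    Vector_Spaces.linear (*\<^sub>m) (*\<^sub>m) \<phi> \<and> bij \<phi> \<and>
    (\<forall>x y. \<phi> (x ** y) = \<phi> x ** \<phi> y) \<and> \<phi> (mat 1) = mat 1"

definition antiautomorphism :: "(complex^'n^'n \<Rightarrow> complex^'n^'n) \<Rightarrow> bool"
  where "antiautomorphism \<phi> \<longleftrightarrow> (\<exists>\<psi>. automorphism \<psi> \<and> \<phi> = \<psi> \<circ> transpose)"

definition mat_unit :: "'n \<Rightarrow> 'n \<Rightarrow> complex^'n^'n"  ("\<e>")
  where "\<e> i j = (\<chi> k l. if k = i \<and> l = j then 1 else 0)"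

text \<open>The index type \<open>3\<close> has the elements \<open>1\<close>, \<open>2\<close> and \<open>3\<close>, where \<open>3 = 0\<close>.\<close>

definition mat3 :: "complex list \<Rightarrow> complex list \<Rightarrow> complex list \<Rightarrow> complex^3^3"
  where "mat3 r\<^sub>1 r\<^sub>2 r\<^sub>3 = vector [vector r\<^sub>1, vector r\<^sub>2, vector r\<^sub>3]"

end

theory Submission
  imports Defs
begin

text \<open>
  Two facts carry the proof. The first is that \<open>B\<close> is the stabilizer of a line, possibly after a
  transposition. Let \<open>M\<close> be the full matrix algebra and \<open>N\<close> the annihilator of \<open>B\<close> for the trace
  form. Then \<open>N\<close> is a two-dimensional
  \<open>B\<close>-bimodule, so for \<open>c\<close> in \<open>N\<close> the right ideal \<open>c M = c A + c B\<close> has dimension at most \<open>4\<close>; since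
  this dimension is three times the rank of \<open>c\<close>, every nonzero \<open>c\<close> in \<open>N\<close> has the form \<open>u w\<^sup>T\<close>
  (\<open>trace_annihilator_minor_zero\<close>). If some \<open>b u\<close> were not a multiple of \<open>u\<close> and some \<open>b'\<^sup>T w\<close> not
  a multiple of \<open>w\<close>, then \<open>u w\<^sup>T\<close>, \<open>(b u) w\<^sup>T\<close> and \<open>u (b'\<^sup>T w)\<^sup>T\<close> would be independent elements of
  \<open>N\<close> (\<open>invariant_line_or_hyperplane\<close>). So \<open>B\<close> or its transpose preserves a line.

  The second is that the complement \<open>A\<close> of such a \<open>B\<close> acts by its own left regular representation.
  If \<open>B u\<close> lies in the line of \<open>u\<close>, then \<open>A u\<close> and \<open>u\<close> span the whole space because \<open>A + B\<close> is the
  full matrix algebra. Hence \<open>a \<mapsto> a u\<close> is an isomorphism of left modules from \<open>A\<close> onto \<open>A u\<close>, and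
  for a basis \<open>x, y\<close> of \<open>A\<close> the vectors \<open>u, x u, y u\<close> form a basis of the space. In this basis \<open>B\<close> is
  the stabilizer of the first coordinate line, and the matrices of \<open>x\<close> and \<open>y\<close> can be read off the
  multiplication table of \<open>A\<close> (\<open>left_regular_normal_form\<close>).

  The conjugacy problem is thereby reduced to the isomorphism problem for two-dimensional associative
  algebras over \<open>\<complex>\<close>. There are seven of them (\<open>plane_algebra_classification\<close>), and their regular
  representations are the first seven alternatives of the theorem, in that order.
\<close>

section \<open>Matrix arithmetic over the complex numbers\<close>

lemma scale_mat_nth [simp]: "(c *\<^sub>m M) $ i $ j = c * M $ i $ j"
  by (simp add: scale_mat_def)

lemma mat_unit_nth [simp]: "\<e> i j $ k $ l = (if k = i \<and> l = j then 1 else 0)"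
  by (simp add: mat_unit_def)

lemma scale_mat_mult_left [simp]: "(c *\<^sub>m x) ** y = c *\<^sub>m (x ** y)"
  by (simp add: vec_eq_iff matrix_matrix_mult_def sum_distrib_left mult.assoc)

lemma scale_mat_mult_right [simp]: "x ** (c *\<^sub>m y) = c *\<^sub>m (x ** y)"
  by (simp add: vec_eq_iff matrix_matrix_mult_def sum_distrib_left algebra_simps)

lemma scale_mat_vector_mult [simp]: "(c *\<^sub>m x) *v v = c *s (x *v v)"
  by (simp add: vec_eq_iff matrix_vector_mult_def sum_distrib_left mult.assoc)

lemma transpose_scale_mat: "transpose (c *\<^sub>m x) = c *\<^sub>m transpose x"
  by (simp add: vec_eq_iff transpose_def)

lemma transpose_add: "transpose (x + y) = transpose x + (transpose y :: 'a::plus^'n^'m)"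
  by (simp add: vec_eq_iff transpose_def)

lemma mat_mult_add_right: "(y + z) ** (x :: complex^'n^'n) = y ** x + z ** x"
  by (simp add: vec_eq_iff matrix_matrix_mult_def sum.distrib algebra_simps)

lemma mat_mult_diff_left: "(x :: complex^'n^'n) ** (y - z) = x ** y - x ** z"
  by (simp add: vec_eq_iff matrix_matrix_mult_def sum_subtractf algebra_simps)

lemma mat_mult_diff_right: "(y - z) ** (x :: complex^'n^'n) = y ** x - z ** x"
  by (simp add: vec_eq_iff matrix_matrix_mult_def sum_subtractf algebra_simps)

lemmas mat_mult_distribs =
  matrix_add_ldistrib mat_mult_add_right mat_mult_diff_left mat_mult_diff_right
  cmat.scale_right_distrib cmat.scale_right_diff_distrib

section \<open>Two-dimensional associative algebras\<close>

definition plane_basis :: "(complex^'n^'n) set \<Rightarrow> complex^'n^'n \<Rightarrow> complex^'n^'n \<Rightarrow> bool" where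
  "plane_basis A x y \<longleftrightarrow> A = cmat.span {x, y} \<and> (\<forall>a b. a *\<^sub>m x + b *\<^sub>m y = 0 \<longrightarrow> a = 0 \<and> b = 0)"

lemma mem_span_pair: "z \<in> cmat.span {x, y} \<longleftrightarrow> (\<exists>a b. z = a *\<^sub>m x + b *\<^sub>m y)"
  by (auto simp: cmat.span_insert cmat.span_singleton algebra_simps)

lemma plane_basisI:
  assumes A: "cmat.subspace A" "cmat.dim A = 2" and xy: "x \<in> A" "y \<in> A" "x \<noteq> 0"
    and y: "y \<notin> cmat.span {x}"
  shows "plane_basis A x y"
proof -
  have ne: "y \<noteq> x" using y cmat.span_base by blast
  have ind: "\<not> cmat.dependent {y, x}"
    using y xy(3) ne by (simp add: cmat.independent_insert)
  obtain T where T: "T \<subseteq> A" "\<not> cmat.dependent T" "A \<subseteq> cmat.span T" "card T = 2"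
    using cmat.basis_exists[of A] A(2) by metis
  have finT: "finite T" using T(4) by (simp add: card_ge_0_finite)
  have "A \<subseteq> cmat.span {y, x}"
  proof
    fix z assume z: "z \<in> A"
    show "z \<in> cmat.span {y, x}"
    proof (rule ccontr)
      assume nz: "z \<notin> cmat.span {y, x}"
      then have "\<not> cmat.dependent {z, y, x}" using ind by (rule cmat.independent_insertI)
      moreover have "{z, y, x} \<subseteq> cmat.span T" using T(3) xy z by blast
      ultimately have "card {z, y, x} \<le> 2"
        using cmat.independent_span_bound[OF finT] T(4) by metis
      moreover have "z \<noteq> y" "z \<noteq> x" using nz cmat.span_base by blast+
      ultimately show False using ne by simp
    qed
  qed
  moreover have "cmat.span {y, x} \<subseteq> A" using xy A(1) by (simp add: cmat.span_minimal)
  ultimately have "A = cmat.span {x, y}" by (simp add: insert_commute)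
  moreover have "a = 0 \<and> b = 0" if h: "a *\<^sub>m x + b *\<^sub>m y = 0" for a b
  proof -
    have b: "b = 0"
    proof (rule ccontr)
      assume b: "b \<noteq> 0"
      have "y = (1/b) *\<^sub>m (b *\<^sub>m y)" using b by simp
      also have "b *\<^sub>m y = (-a) *\<^sub>m x" using h by (simp add: eq_neg_iff_add_eq_0 add.commute)
      finally show False using y by (metis cmat.scale_scale cmat.span_singleton rangeI)
    qed
    with h xy(3) show ?thesis by simp
  qed
  ultimately show ?thesis by (auto simp: plane_basis_def)
qed

lemma plane_basis_coeffs_unique:
  assumes "plane_basis A x y" "a *\<^sub>m x + b *\<^sub>m y = c *\<^sub>m x + d *\<^sub>m y"
  shows "a = c" "b = d"
proof -
  have "(a - c) *\<^sub>m x + (b - d) *\<^sub>m y = 0"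
    using assms(2) by (simp add: cmat.scale_left_diff_distrib algebra_simps)
  then show "a = c" "b = d" using assms(1) unfolding plane_basis_def by fastforce+
qed

definition products ::
    "complex^'n^'n \<Rightarrow> complex^'n^'n \<Rightarrow> complex^'n^'n \<Rightarrow> complex^'n^'n \<Rightarrow> complex^'n^'n \<Rightarrow> complex^'n^'n \<Rightarrow> bool" where
  "products x y xx xy yx yy \<longleftrightarrow> x ** x = xx \<and> x ** y = xy \<and> y ** x = yx \<and> y ** y = yy"

text \<open>
  In order: the zero product; the nilpotent algebra generated by \<open>y\<close> with \<open>y\<^sup>3 = 0\<close>; \<open>\<complex>\<close> plus a zero
  product line; the dual numbers; the product \<open>a b = f(a) b\<close> for a linear form \<open>f\<close>; its opposite
  \<open>a b = f(b) a\<close>; and \<open>\<complex> \<oplus> \<complex>\<close>.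
\<close>

definition standard_plane_algebra :: "complex^'n^'n \<Rightarrow> complex^'n^'n \<Rightarrow> bool" where
  "standard_plane_algebra x y \<longleftrightarrow>
    products x y 0 0 0 0 \<or> products x y 0 0 0 x \<or> products x y x 0 0 0 \<or> products x y x y y 0 \<or>
    products x y x y 0 0 \<or> products x y x 0 y 0 \<or> products x y x 0 0 y"

lemma plane_basis_change:
  assumes b: "plane_basis A x y" and A: "cmat.subspace A" "cmat.dim A = 2"
    and uv: "u = a *\<^sub>m x + b *\<^sub>m y" "v = c *\<^sub>m x + d *\<^sub>m y" and det: "a * d - b * c \<noteq> 0"
  shows "plane_basis A u v"
proof (rule plane_basisI[OF A])
  have Aeq: "A = cmat.span {x, y}" using b by (simp add: plane_basis_def)
  show "u \<in> A" "v \<in> A" unfolding Aeq mem_span_pair using uv by blast+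
  show "u \<noteq> 0"
  proof
    assume "u = 0"
    then have "a = 0" "b = 0" using b uv(1) unfolding plane_basis_def by metis+
    then show False using det by simp
  qed
  show "v \<notin> cmat.span {u}"
  proof
    assume "v \<in> cmat.span {u}"
    then obtain k where "v = k *\<^sub>m u" by (auto simp: cmat.span_singleton)
    then have "c *\<^sub>m x + d *\<^sub>m y = (k * a) *\<^sub>m x + (k * b) *\<^sub>m y"
      using uv by (simp add: mat_mult_distribs)
    from plane_basis_coeffs_unique[OF b this] show False using det by simp
  qed
qed

text \<open>
  Left and right multiplication by the idempotent \<open>e\<close> are commuting projections that fix \<open>e\<close>, so \<open>e\<close>
  can be completed to a basis \<open>e, y\<close> with \<open>e y = b y\<close>, \<open>y e = d y\<close> and \<open>b, d \<in> {0, 1}\<close> (Peirce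
  decomposition). If \<open>b\<close> and \<open>d\<close> differ, then \<open>y y = 0\<close>. If both vanish, \<open>y\<close> spans an ideal. If both
  are \<open>1\<close>, then \<open>e\<close> is a unit and the algebra is a quotient of the polynomial ring by a quadratic.
\<close>

lemma idempotent_plane_algebra:
  assumes A: "subalgebra A" "cmat.dim A = 2" and e: "e \<in> A" "e ** e = e" "e \<noteq> 0"
  shows "\<exists>x y. plane_basis A x y \<and> standard_plane_algebra x y"
proof -
  have sub: "cmat.subspace A" and mul: "\<And>x y. x \<in> A \<Longrightarrow> y \<in> A \<Longrightarrow> x ** y \<in> A"
    using A(1) by (auto simp: subalgebra_def)
  have "\<not> A \<subseteq> cmat.span {e}" using cmat.dim_le_card[of A "{e}"] A(2) by auto
  then obtain z where z: "z \<in> A" "z \<notin> cmat.span {e}" by blast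
  have bz: "plane_basis A e z" by (rule plane_basisI[OF sub A(2) e(1) z(1) e(3) z(2)])
  have coords: "\<exists>a b. w = a *\<^sub>m u + b *\<^sub>m v" if "plane_basis A u v" "w \<in> A" for u v w
    using that by (simp add: plane_basis_def mem_span_pair)
  \<comment> \<open>An eigenvector for left multiplication by \<open>e\<close>; its eigenvalue is \<open>0\<close> or \<open>1\<close> as \<open>e\<close> is idempotent.\<close>
  have "\<exists>y b. plane_basis A e y \<and> e ** y = b *\<^sub>m y \<and> (b = 0 \<or> b = 1)"
  proof -
    obtain a b where ez: "e ** z = a *\<^sub>m e + b *\<^sub>m z" using coords[OF bz mul[OF e(1) z(1)]] by blast
    have "e ** (e ** z) = e ** z" using e(2) by (simp add: matrix_mul_assoc)
    then have "(a + b * a) *\<^sub>m e + (b * b) *\<^sub>m z = a *\<^sub>m e + b *\<^sub>m z"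
      unfolding ez by (simp add: mat_mult_distribs e(2) ez cmat.scale_left_distrib add.assoc)
    from plane_basis_coeffs_unique[OF bz this] have ab: "b * a = 0" "b * b = b" by simp_all
    consider "b = 0" | "b = 1" "a = 0" using ab by auto
    then show ?thesis
    proof cases
      case 1
      have "plane_basis A e (z - a *\<^sub>m e)"
        by (rule plane_basis_change[OF bz sub A(2), where a=1 and b=0 and c="-a" and d=1]) auto
      moreover have "e ** (z - a *\<^sub>m e) = 0 *\<^sub>m (z - a *\<^sub>m e)"
        using 1 by (simp add: mat_mult_distribs e(2) ez)
      ultimately show ?thesis by blast
    next
      case 2 then show ?thesis using bz ez by (intro exI[of _ z] exI[of _ 1]) simp
    qed
  qed
  then obtain y b where y: "plane_basis A e y" "e ** y = b *\<^sub>m y" "b = 0 \<or> b = 1" by blast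
  have yA: "y \<in> A" using y(1) cmat.span_base unfolding plane_basis_def by blast
  \<comment> \<open>The two multiplications commute, so \<open>y\<close> can be corrected without losing its left eigenvalue.\<close>
  have "\<exists>y d. plane_basis A e y \<and> e ** y = b *\<^sub>m y \<and> y ** e = d *\<^sub>m y \<and> (d = 0 \<or> d = 1)"
  proof -
    obtain c d where ye: "y ** e = c *\<^sub>m e + d *\<^sub>m y" using coords[OF y(1) mul[OF yA e(1)]] by blast
    have "(y ** e) ** e = y ** e" using e(2) by (simp flip: matrix_mul_assoc)
    then have "(c + d * c) *\<^sub>m e + (d * d) *\<^sub>m y = c *\<^sub>m e + d *\<^sub>m y"
      unfolding ye by (simp add: mat_mult_distribs e(2) ye cmat.scale_left_distrib add.assoc)
    from plane_basis_coeffs_unique[OF y(1) this] have cd: "d * c = 0" "d * d = d" by simp_all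
    have "e ** (y ** e) = b *\<^sub>m (y ** e)" by (simp add: matrix_mul_assoc y(2))
    then have "c *\<^sub>m e + (d * b) *\<^sub>m y = (b * c) *\<^sub>m e + (b * d) *\<^sub>m y"
      unfolding ye by (simp add: mat_mult_distribs e(2) y(2))
    from plane_basis_coeffs_unique[OF y(1) this] have bc: "c = b * c" by simp
    consider "c = 0" "d = 0 \<or> d = 1" | "d = 0" "b = 1" using cd bc y(3) by auto
    then show ?thesis
    proof cases
      case 1 then show ?thesis using y ye by auto
    next
      case 2
      have "plane_basis A e (y - c *\<^sub>m e)"
        by (rule plane_basis_change[OF y(1) sub A(2), where a=1 and b=0 and c="-c" and d=1]) auto
      then show ?thesis using 2
        by (intro exI[of _ "y - c *\<^sub>m e"] exI[of _ 0]) (simp add: mat_mult_distribs e(2) ye y(2))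
    qed
  qed
  then obtain y d where y: "plane_basis A e y" "e ** y = b *\<^sub>m y" "y ** e = d *\<^sub>m y"
    and bd: "b = 0 \<or> b = 1" "d = 0 \<or> d = 1" using y(3) by blast
  have yA: "y \<in> A" using y(1) cmat.span_base unfolding plane_basis_def by blast
  obtain p q where yy: "y ** y = p *\<^sub>m e + q *\<^sub>m y" using coords[OF y(1) mul[OF yA yA]] by blast
  have mid: "d *\<^sub>m (y ** y) = b *\<^sub>m (y ** y)"
  proof -
    have "d *\<^sub>m (y ** y) = (y ** e) ** y" by (simp add: y(3))
    also have "\<dots> = y ** (e ** y)" by (simp add: matrix_mul_assoc)
    also have "\<dots> = b *\<^sub>m (y ** y)" by (simp add: y(2))
    finally show ?thesis .
  qed
  consider "b \<noteq> d" | "b = 0" "d = 0" | "b = 1" "d = 1" using bd by auto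
  then show ?thesis
  proof cases
    case 1
    have "y ** y = 0" using mid bd 1 by (elim disjE) simp_all
    then have "standard_plane_algebra e y" using 1 y e(2) bd
      by (elim disjE) (simp_all add: standard_plane_algebra_def products_def)
    then show ?thesis using y(1) by blast
  next
    case 2
    have "e ** (y ** y) = 0" using y(2) 2 by (simp add: matrix_mul_assoc)
    then have "p *\<^sub>m e = 0" using 2 by (simp add: yy mat_mult_distribs e(2) y(2))
    then have yy': "y ** y = q *\<^sub>m y" using yy by simp
    show ?thesis
    proof (cases "q = 0")
      case True
      then have "standard_plane_algebra e y" using 2 y e(2) yy'
        by (simp add: standard_plane_algebra_def products_def)
      then show ?thesis using y(1) by blast
    next
      case False
      have "plane_basis A e ((1/q) *\<^sub>m y)"
        by (rule plane_basis_change[OF y(1) sub A(2), where a=1 and b=0 and c=0 and d="1/q"])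
          (use False in auto)
      moreover have "standard_plane_algebra e ((1/q) *\<^sub>m y)"
        using 2 y e(2) yy' False by (simp add: standard_plane_algebra_def products_def)
      ultimately show ?thesis by blast
    qed
  next
    case 3
    \<comment> \<open>Completing the square: \<open>n\<close> is the traceless part of \<open>y\<close> and \<open>D\<close> a quarter of the discriminant.\<close>
    define n where "n = y - (q/2) *\<^sub>m e"
    define D where "D = p + q\<^sup>2 / 4"
    have bn: "plane_basis A e n" unfolding n_def
      by (rule plane_basis_change[OF y(1) sub A(2), where a=1 and b=0 and c="-q/2" and d=1]) auto
    have en: "e ** n = n" "n ** e = n" using 3 y e(2) by (simp_all add: n_def mat_mult_distribs)
    have "n ** n = y ** n - (q/2) *\<^sub>m n" by (subst n_def) (simp add: mat_mult_diff_right en)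
    also have "y ** n = y ** y - (q/2) *\<^sub>m y" using 3 by (simp add: n_def mat_mult_diff_left y(3))
    finally have nn: "n ** n = D *\<^sub>m e"
      by (simp add: yy n_def D_def vec_eq_iff power2_eq_square field_simps)
    have prod: "(k *\<^sub>m e + l *\<^sub>m n) ** (k' *\<^sub>m e + l' *\<^sub>m n) =
        (k * k' + l * l' * D) *\<^sub>m e + (k * l' + l * k') *\<^sub>m n" for k l k' l'
    proof -
      have "(k *\<^sub>m e + l *\<^sub>m n) ** (k' *\<^sub>m e + l' *\<^sub>m n) =
          k *\<^sub>m k' *\<^sub>m e + k *\<^sub>m l' *\<^sub>m n + (l *\<^sub>m k' *\<^sub>m n + l *\<^sub>m l' *\<^sub>m D *\<^sub>m e)"
        by (simp add: matrix_add_ldistrib mat_mult_add_right cmat.scale_right_distrib en e(2) nn mult_ac add_ac)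
      then show ?thesis by (simp add: vec_eq_iff algebra_simps)
    qed
    show ?thesis
    proof (cases "D = 0")
      case True
      then have "standard_plane_algebra e n" using en e(2) nn
        by (simp add: standard_plane_algebra_def products_def)
      then show ?thesis using bn by blast
    next
      case False
      define s where "s = csqrt D"
      have s: "s * s = D" "s \<noteq> 0" using False
        by (auto simp: s_def simp flip: power2_eq_square)
      \<comment> \<open>The orthogonal idempotents are \<open>(e \<plusminus> n / s) / 2\<close>.\<close>
      define t where "t = 1 / (2 * s)"
      have t: "t \<noteq> 0" "t * t * D = 1 / 4" using s(2) by (simp_all add: t_def flip: s(1))
      define u where "u = (1/2) *\<^sub>m e + t *\<^sub>m n"
      define v where "v = (1/2) *\<^sub>m e + (-t) *\<^sub>m n"
      have "plane_basis A u v"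
        by (rule plane_basis_change[OF bn sub A(2) u_def v_def]) (use t(1) in simp)
      moreover have "u ** u = u" "u ** v = 0" "v ** u = 0" "v ** v = v"
        unfolding u_def v_def prod by (simp_all add: t(2))
      then have "standard_plane_algebra u v" by (simp add: standard_plane_algebra_def products_def)
      ultimately show ?thesis by blast
    qed
  qed
qed

text \<open>
  Without a nonzero idempotent the algebra is nilpotent. If some \<open>x\<close> is independent of \<open>x\<^sup>2\<close>, these two
  elements form a basis with \<open>x\<^sup>3 = a x + b x\<^sup>2\<close>, and any nonzero coefficient would produce an
  idempotent. Otherwise every square is a multiple of its root; a nonzero multiple could be rescaled to
  an idempotent, so all squares vanish and the product is alternating, which leaves only the zero product.
\<close>

lemma plane_algebra_classification:
  assumes A: "subalgebra A" "cmat.dim A = 2"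
  shows "\<exists>x y. plane_basis A x y \<and> standard_plane_algebra x y"
proof (cases "\<exists>e\<in>A. e ** e = e \<and> e \<noteq> 0")
  case True then show ?thesis using idempotent_plane_algebra[OF A] by blast
next
  case noidem: False
  have sub: "cmat.subspace A" and mul: "\<And>x y. x \<in> A \<Longrightarrow> y \<in> A \<Longrightarrow> x ** y \<in> A"
    using A(1) by (auto simp: subalgebra_def)
  have scale: "c *\<^sub>m x \<in> A" if "x \<in> A" for c x using cmat.subspace_scale[OF sub that] .
  have coords: "\<exists>a b. w = a *\<^sub>m u + b *\<^sub>m v" if "plane_basis A u v" "w \<in> A" for u v w
    using that by (simp add: plane_basis_def mem_span_pair)
  show ?thesis
  proof (cases "\<exists>x\<in>A. x ** x \<notin> cmat.span {x}")
    case True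
    then obtain x where x: "x \<in> A" "x ** x \<notin> cmat.span {x}" by blast
    define s where "s = x ** x"
    have "x \<noteq> 0" using x cmat.span_zero by auto
    then have bx: "plane_basis A x s" using x mul unfolding s_def by (intro plane_basisI[OF sub A(2)]) auto
    have sA: "s \<in> A" using mul[OF x(1) x(1)] by (simp add: s_def)
    obtain a b where xs: "x ** s = a *\<^sub>m x + b *\<^sub>m s" using coords[OF bx mul[OF x(1) sA]] by blast
    have sx: "s ** x = a *\<^sub>m x + b *\<^sub>m s" using xs by (simp add: s_def matrix_mul_assoc)
    have ss: "s ** s = a *\<^sub>m s + b *\<^sub>m (a *\<^sub>m x + b *\<^sub>m s)"
    proof -
      have "s ** s = x ** (x ** s)" by (simp add: s_def matrix_mul_assoc)
      also have "\<dots> = a *\<^sub>m (x ** x) + b *\<^sub>m (x ** s)" by (simp add: xs mat_mult_distribs)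
      finally show ?thesis by (simp add: xs flip: s_def)
    qed
    have "a = 0"
    proof (rule ccontr)
      assume a: "a \<noteq> 0"
      \<comment> \<open>From \<open>x (x\<^sup>2 - b x) = a x\<close>, the element \<open>(x\<^sup>2 - b x) / a\<close> acts as the identity on the algebra.\<close>
      define e where "e = (-b/a) *\<^sub>m x + (1/a) *\<^sub>m s"
      have "e \<in> A" unfolding e_def using x sA scale cmat.subspace_add[OF sub] by blast
      moreover have "e ** e = e"
        using a by (simp add: e_def mat_mult_distribs xs sx ss flip: s_def)
      moreover have "e \<noteq> 0"
        using bx a unfolding e_def plane_basis_def by (metis divide_eq_0_iff one_neq_zero)
      ultimately show False using noidem by blast
    qed
    have "b = 0"
    proof (rule ccontr)
      assume b: "b \<noteq> 0"
      \<comment> \<open>Now \<open>x\<^sup>3 = b x\<^sup>2\<close>, so \<open>x\<^sup>4 = b\<^sup>2 x\<^sup>2\<close>.\<close>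
      define e where "e = (1/b\<^sup>2) *\<^sub>m s"
      have "e \<in> A" unfolding e_def using sA scale by blast
      moreover have "e ** e = e"
        using b \<open>a = 0\<close> by (simp add: e_def ss power2_eq_square)
      moreover have "e \<noteq> 0"
        using x(2) b cmat.span_zero[of "{x}"] unfolding e_def s_def by fastforce
      ultimately show False using noidem by blast
    qed
    have "plane_basis A s x"
      by (rule plane_basis_change[OF bx sub A(2), where a=0 and b=1 and c=1 and d=0]) auto
    moreover have "standard_plane_algebra s x"
      using \<open>a = 0\<close> \<open>b = 0\<close> xs sx ss by (simp add: standard_plane_algebra_def products_def flip: s_def)
    ultimately show ?thesis by blast
  next
    case False
    have sq: "x ** x = 0" if x: "x \<in> A" for x
    proof (rule ccontr)
      assume nz: "x ** x \<noteq> 0"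
      obtain k where k: "x ** x = k *\<^sub>m x" using False x by (auto simp: cmat.span_singleton)
      then have "k \<noteq> 0" "x \<noteq> 0" using nz by auto
      then have "((1/k) *\<^sub>m x) ** ((1/k) *\<^sub>m x) = (1/k) *\<^sub>m x" "(1/k) *\<^sub>m x \<noteq> 0"
        using k by simp_all
      then show False using noidem scale[OF x] by blast
    qed
    have "\<not> A \<subseteq> cmat.span {0}" using cmat.dim_le_card[of A "{0}"] A(2) by auto
    then obtain x where x: "x \<in> A" "x \<noteq> 0" using cmat.span_zero by blast
    have "\<not> A \<subseteq> cmat.span {x}" using cmat.dim_le_card[of A "{x}"] A(2) by auto
    then obtain y where y: "y \<in> A" "y \<notin> cmat.span {x}" by blast
    have bxy: "plane_basis A x y" by (rule plane_basisI[OF sub A(2) x(1) y(1) x(2) y(2)])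
    obtain a b where xy: "x ** y = a *\<^sub>m x + b *\<^sub>m y" using coords[OF bxy mul[OF x(1) y(1)]] by blast
    have "x ** (x ** y) = 0" using sq x by (simp add: matrix_mul_assoc)
    moreover have "(x ** y) ** y = 0" using sq y by (simp flip: matrix_mul_assoc)
    ultimately have "b *\<^sub>m (x ** y) = 0" "a *\<^sub>m (x ** y) = 0"
      using sq x y by (simp_all add: xy mat_mult_distribs)
    then have xy0: "x ** y = 0" using xy by auto
    have "(x + y) ** (x + y) = 0" using sq cmat.subspace_add[OF sub] x y by blast
    then have "y ** x = 0" using xy0 sq x y by (simp add: mat_mult_distribs)
    then have "standard_plane_algebra x y" using xy0 sq x y
      by (simp add: standard_plane_algebra_def products_def)
    then show ?thesis using bxy by blast
  qed
qed

section \<open>An invariant line or hyperplane\<close>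

lemma trace_add: "trace (x + y) = trace x + trace (y :: complex^'n^'n)"
  by (simp add: trace_def sum.distrib)

lemma trace_diff: "trace (x - y) = trace x - trace (y :: complex^'n^'n)"
  by (simp add: trace_def sum_subtractf)

lemma trace_scale_mat: "trace (c *\<^sub>m x) = c * trace x"
  by (simp add: trace_def sum_distrib_left)

lemma mat_unit_mult_nth: "(\<e> i j ** m) $ r $ s = (if r = i then m $ j $ s else 0)"
  by (simp add: matrix_matrix_mult_def if_distrib[of "\<lambda>t. t * _"] cong: if_cong)

lemma mult_mat_unit_nth: "(m ** \<e> i j) $ r $ s = (if s = j then m $ r $ i else 0)"
  by (simp add: matrix_matrix_mult_def if_distrib[of "\<lambda>t. _ * t"] cong: if_cong)

lemma trace_mult_mat_unit: "trace (m ** \<e> i j) = m $ j $ i"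
  by (simp add: trace_def mult_mat_unit_nth)

lemma trace_form_nondegenerate:
  fixes k :: "complex^'n^'n"
  assumes "\<And>m. trace (k ** m) = 0" shows "k = 0"
  using assms by (metis trace_mult_mat_unit vec_eq_iff zero_index)

lemma mat_unit_expansion: "m = (\<Sum>i\<in>UNIV. \<Sum>j\<in>UNIV. m $ i $ j *\<^sub>m \<e> i j)"
proof -
  have "(\<Sum>i\<in>UNIV. \<Sum>j\<in>UNIV. m $ i $ j *\<^sub>m \<e> i j) $ k $ l = m $ k $ l" for k l
  proof -
    have "(\<Sum>i\<in>UNIV. \<Sum>j\<in>UNIV. m $ i $ j *\<^sub>m \<e> i j) $ k $ l =
        (\<Sum>i\<in>UNIV. \<Sum>j\<in>UNIV. if k = i then if l = j then m $ i $ j else 0 else 0)"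
      by (simp add: if_distrib[of "\<lambda>t. _ * t"] if_conn cong: if_cong)
    also have "\<dots> = (\<Sum>i\<in>UNIV. if k = i then m $ i $ l else 0)"
      by (rule sum.cong) auto
    also have "\<dots> = m $ k $ l" by simp
    finally show ?thesis .
  qed
  then show ?thesis by (simp add: vec_eq_iff)
qed

lemma linear_functional_eq_trace:
  fixes f :: "complex^'n^'n \<Rightarrow> complex"
  assumes add: "\<And>x y. f (x + y) = f x + f y" and scale: "\<And>c x. f (c *\<^sub>m x) = c * f x"
  shows "\<exists>c. \<forall>m. f m = trace (c ** m)"
proof (intro exI allI)
  have zero: "f 0 = 0" using scale[of 0 0] by simp
  have sum: "f (sum g S) = (\<Sum>i\<in>S. f (g i))" if "finite S" for g and S :: "'n set"
    using that by induction (simp_all add: add zero)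
  fix m
  have "f m = (\<Sum>i\<in>UNIV. \<Sum>j\<in>UNIV. m $ i $ j * f (\<e> i j))"
    by (subst mat_unit_expansion) (simp add: sum scale)
  also have "\<dots> = (\<Sum>j\<in>UNIV. \<Sum>i\<in>UNIV. m $ i $ j * f (\<e> i j))" by (rule sum.swap)
  also have "\<dots> = trace ((\<chi> j i. f (\<e> i j)) ** m)"
    by (simp add: trace_def matrix_matrix_mult_def mult.commute)
  finally show "f m = trace ((\<chi> j i. f (\<e> i j)) ** m)" .
qed

text \<open>
  The \<open>A\<close>-coordinates of a matrix along \<open>A \<oplus> B\<close> are linear functionals that vanish on \<open>B\<close>. The
  matrices representing them are a basis of the trace annihilator of \<open>B\<close>, which bounds its
  dimension by \<open>2\<close> and shows that it is nonzero.
\<close>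

lemma direct_sum_coordinates:
  assumes AB: "direct_sum_decomp A B" and xy: "plane_basis A x y"
  shows "\<exists>s t b. b \<in> B \<and> m = s *\<^sub>m x + t *\<^sub>m y + b"
    and "\<exists>c d. \<forall>s t. \<forall>b\<in>B. trace (c ** (s *\<^sub>m x + t *\<^sub>m y + b)) = s \<and>
      trace (d ** (s *\<^sub>m x + t *\<^sub>m y + b)) = t"
proof -
  have subB: "cmat.subspace B" and int: "A \<inter> B = {0}"
    and sum: "\<And>m. \<exists>a\<in>A. \<exists>b\<in>B. m = a + b"
    using AB unfolding direct_sum_decomp_def by blast+
  have memA: "a \<in> A \<longleftrightarrow> (\<exists>s t. a = s *\<^sub>m x + t *\<^sub>m y)" for a
    using xy by (simp add: plane_basis_def mem_span_pair)
  have ex: "\<exists>s t b. b \<in> B \<and> m = s *\<^sub>m x + t *\<^sub>m y + b" for m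
    using sum[of m] memA by metis
  then obtain f g r where r: "\<And>m. r m \<in> B" and m: "\<And>m. m = f m *\<^sub>m x + g m *\<^sub>m y + r m"
    by metis
  have unique: "s = f m" "t = g m" if "b \<in> B" and e: "m = s *\<^sub>m x + t *\<^sub>m y + b" for m s t b
  proof -
    have "(s - f m) *\<^sub>m x + (t - g m) *\<^sub>m y = r m - b"
      using m[of m] e by (simp add: cmat.scale_left_diff_distrib algebra_simps)
    moreover have "r m - b \<in> B" using cmat.subspace_diff[OF subB r that(1)] .
    ultimately have "(s - f m) *\<^sub>m x + (t - g m) *\<^sub>m y \<in> A \<inter> B" using memA by (metis IntI)
    then have "(s - f m) *\<^sub>m x + (t - g m) *\<^sub>m y = 0" using int by auto
    then show "s = f m" "t = g m" using xy unfolding plane_basis_def by fastforce+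
  qed
  have add: "f (m + n) = f m + f n \<and> g (m + n) = g m + g n" for m n
  proof -
    have "m + n = (f m *\<^sub>m x + g m *\<^sub>m y + r m) + (f n *\<^sub>m x + g n *\<^sub>m y + r n)"
      by (rule arg_cong2[where f="(+)", OF m m])
    also have "\<dots> = (f m + f n) *\<^sub>m x + (g m + g n) *\<^sub>m y + (r m + r n)"
      by (simp add: cmat.scale_left_distrib add_ac)
    finally have e: "m + n = (f m + f n) *\<^sub>m x + (g m + g n) *\<^sub>m y + (r m + r n)" .
    from unique[OF cmat.subspace_add[OF subB r r] e] show ?thesis by simp
  qed
  have scale: "f (k *\<^sub>m m) = k * f m \<and> g (k *\<^sub>m m) = k * g m" for k m
  proof -
    have "k *\<^sub>m m = (k * f m) *\<^sub>m x + (k * g m) *\<^sub>m y + k *\<^sub>m r m"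
      using arg_cong[OF m, of "\<lambda>n. k *\<^sub>m n" m] by (simp only: cmat.scale_right_distrib cmat.scale_scale)
    from unique[OF cmat.subspace_scale[OF subB r] this] show ?thesis by simp
  qed
  obtain c where c: "\<And>m. f m = trace (c ** m)"
    using linear_functional_eq_trace[OF add[THEN conjunct1] scale[THEN conjunct1]] by blast
  obtain d where d: "\<And>m. g m = trace (d ** m)"
    using linear_functional_eq_trace[OF add[THEN conjunct2] scale[THEN conjunct2]] by blast
  have "trace (c ** (s *\<^sub>m x + t *\<^sub>m y + b)) = s \<and> trace (d ** (s *\<^sub>m x + t *\<^sub>m y + b)) = t"
    if "b \<in> B" for s t b
    unfolding c[symmetric] d[symmetric] using unique[OF that refl, symmetric] by blast
  then show "\<exists>c d. \<forall>s t. \<forall>b\<in>B. trace (c ** (s *\<^sub>m x + t *\<^sub>m y + b)) = s \<and>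
      trace (d ** (s *\<^sub>m x + t *\<^sub>m y + b)) = t"
    by blast
  show "\<exists>s t b. b \<in> B \<and> m = s *\<^sub>m x + t *\<^sub>m y + b" by (rule ex)
qed

definition trace_annihilator where
  "trace_annihilator B = {c. \<forall>b\<in>B. trace (c ** b) = 0}"

text \<open>
  The annihilator is stable on the right because \<open>B\<close> is closed under products, and on the left because
  moreover the trace is cyclic.
\<close>

lemma trace_annihilator_bimodule:
  assumes "subalgebra B" "c \<in> trace_annihilator B" "b \<in> B"
  shows "c ** b \<in> trace_annihilator B" "b ** c \<in> trace_annihilator B"
proof -
  have closed: "x ** y \<in> B" if "x \<in> B" "y \<in> B" for x y using assms(1) that by (auto simp: subalgebra_def)
  show "c ** b \<in> trace_annihilator B"
    using assms(2,3) closed by (simp add: trace_annihilator_def flip: matrix_mul_assoc)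
  have "trace (b ** c ** b') = trace (c ** (b' ** b))" for b'
    by (metis matrix_mul_assoc trace_mul_sym)
  then show "b ** c \<in> trace_annihilator B"
    using assms(2,3) closed by (simp add: trace_annihilator_def)
qed

lemma mat_unit_eq_iff: "\<e> i j = \<e> k l \<longleftrightarrow> i = k \<and> j = l"
  by (metis mat_unit_nth zero_neq_one)

lemma independent_mat_units: "\<not> cmat.dependent ((\<lambda>(i, j). \<e> i j) ` I)"
proof
  assume "cmat.dependent ((\<lambda>(i, j). \<e> i j) ` I)"
  then obtain i j where ij: "\<e> i j \<in> cmat.span ((\<lambda>(i, j). \<e> i j) ` I - {\<e> i j})"
    by (auto simp: cmat.dependent_def)
  have "cmat.subspace {m. m $ i $ j = 0}" by (auto simp: cmat.subspace_def)
  then have "cmat.span ((\<lambda>(i, j). \<e> i j) ` I - {\<e> i j}) \<subseteq> {m. m $ i $ j = 0}"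
    by (rule cmat.span_minimal[rotated]) auto
  then show False using ij by auto
qed

text \<open>
  Let \<open>M\<close> be the full matrix algebra and \<open>A\<close> the plane spanned by \<open>x\<close> and \<open>y\<close>. A nonzero minor of
  \<open>c\<close> would give \<open>c M\<close> dimension at least \<open>6\<close>. But \<open>c M = c A + c B\<close>, and \<open>c B\<close>
  lies in the annihilator, so \<open>c M\<close> is spanned by \<open>c x\<close>, \<open>c y\<close> and the two generators of the
  annihilator. To make the six independent elements visible, a matrix \<open>L\<close> built from the inverse of the
  minor moves the relevant columns \<open>p\<close> and \<open>q\<close> of \<open>c\<close> to the first two coordinate vectors.
\<close>

lemma trace_annihilator_minor_zero:
  fixes B :: "(complex^3^3) set"
  assumes B: "subalgebra B" and ann: "trace_annihilator B \<subseteq> cmat.span {c\<^sub>1, c\<^sub>2}"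
    and dec: "\<And>m. \<exists>s t b. b \<in> B \<and> m = s *\<^sub>m x + t *\<^sub>m y + b"
    and c: "c \<in> trace_annihilator B"
  shows "c $ i $ p * c $ k $ q = c $ i $ q * c $ k $ p"
proof (rule ccontr)
  define D where "D = c $ i $ p * c $ k $ q - c $ i $ q * c $ k $ p"
  assume "\<not> ?thesis"
  then have D: "D \<noteq> 0" by (simp add: D_def)
  define L :: "complex^3^3" where
    "L = (c $ k $ q / D) *\<^sub>m \<e> 1 i - (c $ i $ q / D) *\<^sub>m \<e> 1 k + (c $ i $ p / D) *\<^sub>m \<e> 2 k - (c $ k $ p / D) *\<^sub>m \<e> 2 i"
  define T where "T = {L ** (c ** x), L ** (c ** y), L ** c\<^sub>1, L ** c\<^sub>2}"
  \<comment> \<open>The inclusion of \<open>c M\<close> in the sum of \<open>c A\<close> and the annihilator, multiplied by \<open>L\<close>.\<close>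
  have in_span: "L ** (c ** m) \<in> cmat.span T" for m
  proof -
    obtain s t b where b: "b \<in> B" and m: "m = s *\<^sub>m x + t *\<^sub>m y + b" using dec by blast
    obtain \<alpha> \<beta> where "c ** b = \<alpha> *\<^sub>m c\<^sub>1 + \<beta> *\<^sub>m c\<^sub>2"
      using trace_annihilator_bimodule(1)[OF B c b] ann mem_span_pair by blast
    then have "L ** (c ** m) = s *\<^sub>m L ** (c ** x) + t *\<^sub>m L ** (c ** y) + (\<alpha> *\<^sub>m L ** c\<^sub>1 + \<beta> *\<^sub>m L ** c\<^sub>2)"
      by (simp add: m mat_mult_distribs)
    also have "\<dots> \<in> cmat.span T" unfolding scale_mat_mult_left
      by (intro cmat.span_add cmat.span_scale cmat.span_base) (auto simp: T_def)
    finally show ?thesis .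
  qed
  \<comment> \<open>The first two rows of \<open>L\<close> are dual to the columns \<open>p\<close> and \<open>q\<close> of \<open>c\<close>.\<close>
  have "c $ k $ q / D * c $ i $ p - c $ i $ q / D * c $ k $ p = 1"
    "c $ k $ q / D * c $ i $ q - c $ i $ q / D * c $ k $ q = 0"
    "c $ i $ p / D * c $ k $ p - c $ k $ p / D * c $ i $ p = 0"
    "c $ i $ p / D * c $ k $ q - c $ k $ p / D * c $ i $ q = 1"
    using D by (simp_all add: mult.commute flip: diff_divide_distrib D_def)
  then have "L ** (c ** \<e> p j) = \<e> 1 j" "L ** (c ** \<e> q j) = \<e> 2 j" for j
    by (simp_all add: vec_eq_iff L_def mat_mult_distribs mat_unit_mult_nth mult_mat_unit_nth)
  then have "\<e> 1 j \<in> cmat.span T" "\<e> 2 j \<in> cmat.span T" for j using in_span by metis+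
  then have "(\<lambda>(i, j). \<e> i j) ` ({1, 2} \<times> (UNIV :: 3 set)) \<subseteq> cmat.span T" by auto
  then have "card ((\<lambda>(i, j). \<e> i j) ` ({1, 2} \<times> (UNIV :: 3 set))) \<le> card T"
    by (intro cmat.independent_span_bound[THEN conjunct2] independent_mat_units) (simp add: T_def)
  moreover have "inj_on (\<lambda>(i, j). \<e> i j) ({1, 2 :: 3} \<times> (UNIV :: 3 set))"
    by (auto simp: inj_on_def mat_unit_eq_iff)
  then have "card ((\<lambda>(i, j). \<e> i j) ` ({1, 2 :: 3} \<times> (UNIV :: 3 set))) = 6"
    by (simp add: card_image card_cartesian_product)
  moreover have "card T \<le> 4" unfolding T_def
    using card_length[of "[L ** (c ** x), L ** (c ** y), L ** c\<^sub>1, L ** c\<^sub>2]"] by simp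
  ultimately show False by linarith
qed

definition outer_prod :: "complex^'n \<Rightarrow> complex^'n \<Rightarrow> complex^'n^'n"
  where "outer_prod u w = (\<chi> i j. u $ i * w $ j)"

lemma mult_outer_prod: "m ** outer_prod u w = outer_prod (m *v u) w"
  by (simp add: vec_eq_iff outer_prod_def matrix_matrix_mult_def matrix_vector_mult_def
      sum_distrib_right mult.assoc)

lemma outer_prod_mult: "outer_prod u w ** m = outer_prod u (transpose m *v w)"
  by (simp add: vec_eq_iff outer_prod_def matrix_matrix_mult_def matrix_vector_mult_def
      transpose_def sum_distrib_left mult_ac)

lemma rank_one_of_minors_zero:
  fixes c :: "complex^'n^'n"
  assumes c: "c \<noteq> 0" and minors: "\<And>i k p q. c $ i $ p * c $ k $ q = c $ i $ q * c $ k $ p"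
  obtains u w where "u \<noteq> 0" "w \<noteq> 0" "c = outer_prod u w"
proof -
  obtain i p where ip: "c $ i $ p \<noteq> 0" using c by (auto simp: vec_eq_iff)
  let ?u = "\<chi> r. c $ r $ p" and ?w = "\<chi> s. c $ i $ s / c $ i $ p"
  have "c = outer_prod ?u ?w"
    using ip minors by (simp add: vec_eq_iff outer_prod_def field_simps)
  moreover have "?u \<noteq> 0" "?w \<noteq> 0" using ip by (auto simp: vec_eq_iff)
  ultimately show thesis using that by blast
qed

lemma independent_outer_prods:
  assumes u: "u \<noteq> 0" and w: "w \<noteq> 0" and u': "\<And>k. u' \<noteq> k *s u" and w': "\<And>k. w' \<noteq> k *s w"
  shows "\<not> cmat.dependent {outer_prod u' w, outer_prod u w', outer_prod u w}"
    and "card {outer_prod u' w, outer_prod u w', outer_prod u w} = 3"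
proof -
  obtain i where i: "u $ i \<noteq> 0" using u by (auto simp: vec_eq_iff)
  obtain j where j: "w $ j \<noteq> 0" using w by (auto simp: vec_eq_iff)
  have nz: "outer_prod u w \<noteq> 0" using i j by (auto simp: outer_prod_def vec_eq_iff)
  have 1: "outer_prod u w' \<notin> cmat.span {outer_prod u w}"
  proof
    assume "outer_prod u w' \<in> cmat.span {outer_prod u w}"
    then obtain k where k: "outer_prod u w' = k *\<^sub>m outer_prod u w" by (auto simp: cmat.span_singleton)
    have "w' $ s = k * w $ s" for s
      using i arg_cong[OF k, of "\<lambda>m. m $ i $ s"] by (simp add: outer_prod_def)
    then have "w' = k *s w" by (simp add: vec_eq_iff)
    then show False using w' by blast
  qed
  have 2: "outer_prod u' w \<notin> cmat.span {outer_prod u w', outer_prod u w}"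
  proof
    assume "outer_prod u' w \<in> cmat.span {outer_prod u w', outer_prod u w}"
    then obtain k l where "outer_prod u' w = k *\<^sub>m outer_prod u w' + l *\<^sub>m outer_prod u w"
      unfolding mem_span_pair by blast
    then have "u' $ r * w $ j = (k * w' $ j + l * w $ j) * u $ r" for r
      by (simp add: vec_eq_iff outer_prod_def algebra_simps)
    then have "u' = ((k * w' $ j + l * w $ j) / w $ j) *s u" using j
      by (simp add: vec_eq_iff field_simps)
    then show False using u' by blast
  qed
  have "outer_prod u w' \<noteq> outer_prod u w" "outer_prod u' w \<noteq> outer_prod u w'"
    "outer_prod u' w \<noteq> outer_prod u w"
    using 1 2 cmat.span_superset[of "{outer_prod u w}"]
      cmat.span_superset[of "{outer_prod u w', outer_prod u w}"] by auto
  then show "\<not> cmat.dependent {outer_prod u' w, outer_prod u w', outer_prod u w}"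
    and "card {outer_prod u' w, outer_prod u w', outer_prod u w} = 3"
    using nz 1 2 by (simp_all add: cmat.independent_insert)
qed

text \<open>
  The annihilator contains some \<open>u w\<^sup>T \<noteq> 0\<close>. As a bimodule it also contains all \<open>(b u) w\<^sup>T\<close> and all
  \<open>u (b\<^sup>T w)\<^sup>T\<close>, and its dimension leaves no room for both families to leave the line of \<open>u w\<^sup>T\<close>. The
  two alternatives are exchanged by transposition.
\<close>

lemma invariant_line_or_hyperplane:
  fixes A B :: "(complex^3^3) set"
  assumes B: "subalgebra B" and AB: "direct_sum_decomp A B" and xy: "plane_basis A x y"
  shows "(\<exists>u. u \<noteq> 0 \<and> (\<forall>b\<in>B. \<exists>k. b *v u = k *s u)) \<or>
    (\<exists>w. w \<noteq> 0 \<and> (\<forall>b\<in>B. \<exists>k. transpose b *v w = k *s w))"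
proof (rule ccontr)
  assume contra: "\<not> ?thesis"
  note dec = direct_sum_coordinates(1)[OF AB xy]
  obtain c d where cd: "\<forall>s t. \<forall>b\<in>B. trace (c ** (s *\<^sub>m x + t *\<^sub>m y + b)) = s \<and>
      trace (d ** (s *\<^sub>m x + t *\<^sub>m y + b)) = t"
    using direct_sum_coordinates(2)[OF AB xy] by blast
  then have c: "trace (c ** (s *\<^sub>m x + t *\<^sub>m y + b)) = s"
    and d: "trace (d ** (s *\<^sub>m x + t *\<^sub>m y + b)) = t" if "b \<in> B" for s t b
    using that by blast+
  \<comment> \<open>A functional vanishing on \<open>B\<close> is determined by its values on \<open>x\<close> and \<open>y\<close>.\<close>
  have ann: "trace_annihilator B \<subseteq> cmat.span {c, d}"
  proof
    fix n assume n: "n \<in> trace_annihilator B"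
    let ?k = "n - (trace (n ** x) *\<^sub>m c + trace (n ** y) *\<^sub>m d)"
    have "trace (?k ** m) = 0" for m
    proof -
      obtain s t b where b: "b \<in> B" and m: "m = s *\<^sub>m x + t *\<^sub>m y + b" using dec by blast
      have "trace (c ** m) = s" "trace (d ** m) = t" unfolding m by (rule c[OF b], rule d[OF b])
      moreover have "trace (n ** b) = 0" using n b by (simp add: trace_annihilator_def)
      then have "trace (n ** m) = s * trace (n ** x) + t * trace (n ** y)"
        by (simp add: m matrix_add_ldistrib trace_add trace_scale_mat)
      ultimately show ?thesis
        by (simp add: mat_mult_diff_right mat_mult_add_right trace_add trace_diff trace_scale_mat)
    qed
    then have "?k = 0" by (rule trace_form_nondegenerate)
    then show "n \<in> cmat.span {c, d}" unfolding mem_span_pair by auto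
  qed
  have cB: "c \<in> trace_annihilator B" using c[of _ 0 0] by (simp add: trace_annihilator_def)
  have "0 \<in> B" using B by (simp add: subalgebra_def cmat.subspace_0)
  then have "c \<noteq> 0" using c[of 0 1 0] by (auto simp: trace_def)
  then obtain u w where uw: "u \<noteq> 0" "w \<noteq> 0" and c_eq: "c = outer_prod u w"
    using trace_annihilator_minor_zero[OF B ann dec cB] by (rule rank_one_of_minors_zero)
  obtain b where b: "b \<in> B" "\<And>k. b *v u \<noteq> k *s u" using contra uw(1) by blast
  obtain b' where b': "b' \<in> B" "\<And>k. transpose b' *v w \<noteq> k *s w" using contra uw(2) by blast
  let ?S = "{outer_prod (b *v u) w, outer_prod u (transpose b' *v w), outer_prod u w}"
  have "?S \<subseteq> cmat.span {c, d}"
    using ann cB trace_annihilator_bimodule(1)[OF B cB b'(1)] trace_annihilator_bimodule(2)[OF B cB b(1)]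
    unfolding c_eq mult_outer_prod outer_prod_mult by blast
  then have "card ?S \<le> card {c, d}"
    by (intro cmat.independent_span_bound[THEN conjunct2] independent_outer_prods(1)[OF uw b(2) b'(2)]) simp
  also have "\<dots> \<le> 2" by (simp add: card_insert_if)
  finally show False using independent_outer_prods(2)[OF uw b(2) b'(2)] by simp
qed

section \<open>Transposing a decomposition\<close>

lemma mem_transpose_image: "m \<in> transpose ` X \<longleftrightarrow> transpose m \<in> X"
  by (metis image_iff transpose_transpose)

lemma direct_sum_decomp_transpose:
  assumes "direct_sum_decomp A B"
  shows "direct_sum_decomp (transpose ` A) (transpose ` B)"
proof -
  have sub: "cmat.subspace (transpose ` X)" if "cmat.subspace X" for X :: "(complex^'n^'n) set"
    using that
    by (auto simp: cmat.subspace_def mem_transpose_image transpose_add transpose_scale_mat)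
      (metis cmat.scale_zero_left transpose_scale_mat)
  have zero: "transpose (0 :: complex^'n^'n) = 0" by (simp add: transpose_def vec_eq_iff)
  have inj: "inj (transpose :: complex^'n^'n \<Rightarrow> _)" by (metis injI transpose_transpose)
  have "transpose ` A \<inter> transpose ` B = {0}"
    using assms zero by (simp add: direct_sum_decomp_def flip: image_Int[OF inj])
  moreover have "m \<in> {a + b |a b. a \<in> transpose ` A \<and> b \<in> transpose ` B}" for m
  proof -
    have "transpose m \<in> {a + b |a b. a \<in> A \<and> b \<in> B}" using assms by (simp add: direct_sum_decomp_def)
    then obtain a b where ab: "a \<in> A" "b \<in> B" "transpose m = a + b" by blast
    then have "m = transpose a + transpose b" by (metis transpose_add transpose_transpose)
    then show ?thesis using ab by blast
  qed
  ultimately show ?thesis using assms sub by (auto simp: direct_sum_decomp_def)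
qed

lemma plane_basis_transpose:
  assumes "plane_basis A x y"
  shows "plane_basis (transpose ` A) (transpose x) (transpose y)"
proof -
  have "transpose ` cmat.span {x, y} = cmat.span {transpose x, transpose y}"
  proof (rule set_eqI)
    fix z
    have "transpose z = a *\<^sub>m x + b *\<^sub>m y \<longleftrightarrow> z = a *\<^sub>m transpose x + b *\<^sub>m transpose y" for a b
      by (metis transpose_add transpose_scale_mat transpose_transpose)
    then show "z \<in> transpose ` cmat.span {x, y} \<longleftrightarrow> z \<in> cmat.span {transpose x, transpose y}"
      by (simp add: mem_transpose_image mem_span_pair)
  qed
  moreover have "a = 0 \<and> b = 0" if "a *\<^sub>m transpose x + b *\<^sub>m transpose y = 0" for a b
  proof -
    have "transpose (a *\<^sub>m x + b *\<^sub>m y) = 0" using that by (simp add: transpose_add transpose_scale_mat)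
    then have "a *\<^sub>m x + b *\<^sub>m y = 0" by (simp add: transpose_def vec_eq_iff)
    then show ?thesis using assms by (auto simp: plane_basis_def)
  qed
  ultimately show ?thesis using assms by (auto simp: plane_basis_def)
qed

lemma products_transpose:
  "products x y xx xy yx yy \<Longrightarrow>
    products (transpose x) (transpose y) (transpose xx) (transpose yx) (transpose xy) (transpose yy)"
  by (auto simp: products_def matrix_transpose_mul)

text \<open>
  Transposition passes to the opposite algebra. Five of the seven tables are commutative, and the
  other two are opposite to each other.
\<close>

lemma standard_plane_algebra_transpose:
  assumes "standard_plane_algebra x y"
  shows "standard_plane_algebra (transpose x) (transpose y)"
proof -
  have zero: "transpose (0 :: complex^'n^'n) = 0" by (simp add: transpose_def vec_eq_iff)
  from assms show ?thesis unfolding standard_plane_algebra_def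
    by (elim disjE) (drule products_transpose, simp add: zero)+
qed

section \<open>The left regular representation\<close>

definition parabolic :: "(complex^3^3) set" where
  "parabolic = cmat.span {\<e> 1 1, \<e> 1 2, \<e> 1 3, \<e> 2 2, \<e> 2 3, \<e> 3 2, \<e> 3 3}"

lemma mem_parabolic_iff: "m \<in> parabolic \<longleftrightarrow> m $ 2 $ 1 = 0 \<and> m $ 3 $ 1 = 0"
proof
  have "cmat.subspace {m :: complex^3^3. m $ 2 $ 1 = 0 \<and> m $ 3 $ 1 = 0}"
    by (auto simp: cmat.subspace_def)
  then have "parabolic \<subseteq> {m. m $ 2 $ 1 = 0 \<and> m $ 3 $ 1 = 0}"
    unfolding parabolic_def by (rule cmat.span_minimal[rotated]) auto
  then show "m $ 2 $ 1 = 0 \<and> m $ 3 $ 1 = 0" if "m \<in> parabolic" using that by blast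
next
  assume "m $ 2 $ 1 = 0 \<and> m $ 3 $ 1 = 0"
  then have "m = m $ 1 $ 1 *\<^sub>m \<e> 1 1 + m $ 1 $ 2 *\<^sub>m \<e> 1 2 + m $ 1 $ 3 *\<^sub>m \<e> 1 3 +
      m $ 2 $ 2 *\<^sub>m \<e> 2 2 + m $ 2 $ 3 *\<^sub>m \<e> 2 3 + m $ 3 $ 2 *\<^sub>m \<e> 3 2 + m $ 3 $ 3 *\<^sub>m \<e> 3 3"
    by (simp add: vec_eq_iff forall_3)
  also have "\<dots> \<in> parabolic" unfolding parabolic_def
    by (intro cmat.span_add cmat.span_scale cmat.span_base) auto
  finally show "m \<in> parabolic" .
qed

lemma conjugation_automorphism:
  assumes "g ** g' = mat 1" "g' ** g = mat 1"
  shows "automorphism (\<lambda>m. g' ** m ** g)"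
  unfolding automorphism_def
proof (intro conjI allI)
  show "Vector_Spaces.linear (*\<^sub>m) (*\<^sub>m) (\<lambda>m. g' ** m ** g)"
    by (simp add: Vector_Spaces.linear_iff cmat.vector_space_axioms mat_mult_distribs)
  have "g ** (g' ** m ** g) ** g' = m" "g' ** (g ** m ** g') ** g = m" for m
    using assms by (metis matrix_mul_assoc matrix_mul_lid matrix_mul_rid)+
  then show "bij (\<lambda>m. g' ** m ** g)" by (intro o_bij[of "\<lambda>m. g ** m ** g'"]) auto
  show "g' ** (x ** y) ** g = g' ** x ** g ** (g' ** y ** g)" for x y
    using assms(1) by (metis matrix_mul_assoc matrix_mul_rid)
  show "g' ** mat 1 ** g = mat 1" using assms by simp
qed

text \<open>
  The lower right block, with columns \<open>(a, b)\<close> and \<open>(c, d)\<close>, is left multiplication by an element \<open>z\<close>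
  with \<open>z x = a x + b y\<close> and \<open>z y = c x + d y\<close>.
\<close>

definition left_regular_mat :: "complex \<Rightarrow> complex \<Rightarrow> complex \<Rightarrow> complex \<Rightarrow> complex^3^3" where
  "left_regular_mat a b c d = a *\<^sub>m \<e> 2 2 + b *\<^sub>m \<e> 3 2 + c *\<^sub>m \<e> 2 3 + d *\<^sub>m \<e> 3 3"

lemma mult_axis_nth: "((m :: complex^'n^'n) *v axis j 1) $ i = m $ i $ j"
  by (simp add: matrix_vector_mult_def axis_def if_distrib[of "\<lambda>t. _ * t"] cong: if_cong)

text \<open>
  The automorphism is the change to the basis \<open>u, x u, y u\<close>. These vectors span because every vector
  is \<open>m u\<close> for some \<open>m = s x + t y + b\<close>, and \<open>b u\<close> is a multiple of \<open>u\<close>. The same expansion shows that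
  the coordinates of \<open>m u\<close> on \<open>x u\<close> and \<open>y u\<close> are \<open>s\<close> and \<open>t\<close>, so they vanish exactly when \<open>m\<close> lies in
  \<open>B\<close>. Finally \<open>x\<close> sends \<open>u\<close> to the second basis vector and acts on \<open>x u\<close> and \<open>y u\<close> by the
  multiplication table, and likewise for \<open>y\<close>.
\<close>

lemma left_regular_normal_form:
  fixes A B :: "(complex^3^3) set"
  assumes AB: "direct_sum_decomp A B" and xy: "plane_basis A x y"
    and u: "u \<noteq> 0" "\<forall>b\<in>B. \<exists>k. b *v u = k *s u"
  shows "\<exists>\<phi>. automorphism \<phi> \<and> \<phi> ` B = parabolic \<and> \<phi> ` A = cmat.span {\<phi> x, \<phi> y} \<and>
    (\<forall>a b c d. x ** x = a *\<^sub>m x + b *\<^sub>m y \<longrightarrow> x ** y = c *\<^sub>m x + d *\<^sub>m y \<longrightarrow>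
      \<phi> x = \<e> 2 1 + left_regular_mat a b c d) \<and>
    (\<forall>a b c d. y ** x = a *\<^sub>m x + b *\<^sub>m y \<longrightarrow> y ** y = c *\<^sub>m x + d *\<^sub>m y \<longrightarrow>
      \<phi> y = \<e> 3 1 + left_regular_mat a b c d)"
proof -
  have memA: "a \<in> A \<longleftrightarrow> (\<exists>s t. a = s *\<^sub>m x + t *\<^sub>m y)" for a
    using xy by (simp add: plane_basis_def mem_span_pair)
  note dec = direct_sum_coordinates(1)[OF AB xy]
  define g :: "complex^3^3" where
    "g = (\<chi> i j. if j = 1 then u $ i else if j = 2 then (x *v u) $ i else (y *v u) $ i)"
  have g_nth: "g $ i $ 1 = u $ i" "g $ i $ 2 = (x *v u) $ i" "g $ i $ 3 = (y *v u) $ i" for i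
    by (simp_all add: g_def)
  have "\<exists>v. g *v v = w" for w
  proof -
    obtain i where i: "u $ i \<noteq> 0" using u(1) by (auto simp: vec_eq_iff)
    \<comment> \<open>A rank one matrix taking \<open>u\<close> to \<open>w\<close>.\<close>
    define m :: "complex^3^3" where "m = outer_prod w (axis i (1 / u $ i))"
    have "m *v u = w" using i
      by (simp add: m_def outer_prod_def vec_eq_iff matrix_vector_mult_def axis_def
        if_distrib[of "\<lambda>t. _ * t"] if_distrib[of "\<lambda>t. t * _"] cong: if_cong)
    moreover obtain s t b where b: "b \<in> B" and m: "m = s *\<^sub>m x + t *\<^sub>m y + b" using dec by blast
    moreover obtain k where "b *v u = k *s u" using u(2) b by blast
    ultimately have "w = s *s (x *v u) + t *s (y *v u) + k *s u"
      by (metis matrix_vector_mult_add_rdistrib scale_mat_vector_mult)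
    then have "g *v vector [k, s, t] = w"
      by (simp add: vec_eq_iff matrix_vector_mult_def[of g] sum_3 g_nth)
    then show ?thesis by blast
  qed
  then obtain g' where gg': "g ** g' = mat 1"
    using matrix_right_invertible_surjective[of g] by (metis surj_def)
  then have g'g: "g' ** g = mat 1" by (simp add: matrix_left_right_inverse)
  define \<phi> where "\<phi> m = g' ** m ** g" for m
  have g\<phi>: "g ** \<phi> m = m ** g" for m
    using gg' by (simp add: \<phi>_def matrix_mul_assoc)
  have \<phi>_eqI: "\<phi> m = n" if "m ** g = g ** n" for m n
    using that g'g by (metis g\<phi> matrix_mul_assoc matrix_mul_lid)
  have mg: "(m ** g) $ i $ 1 = (m *v u) $ i" "(m ** g) $ i $ 2 = (m ** x *v u) $ i"
    "(m ** g) $ i $ 3 = (m ** y *v u) $ i" for m i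
    by (simp_all add: matrix_matrix_mult_def[of m g] g_nth matrix_vector_mult_def[of m]
        flip: matrix_vector_mul_assoc)
  have gn: "(g ** n) $ i $ j = u $ i * n $ 1 $ j + (x *v u) $ i * n $ 2 $ j + (y *v u) $ i * n $ 3 $ j"
    for n i j
    by (simp add: matrix_matrix_mult_def[of g] sum_3 g_nth)
  have auto: "automorphism \<phi>"
    using conjugation_automorphism[OF gg' g'g] by (simp add: \<phi>_def[abs_def])
  have lin: "\<phi> (m + n) = \<phi> m + \<phi> n" "\<phi> (c *\<^sub>m m) = c *\<^sub>m \<phi> m" for m n c
    by (simp_all add: \<phi>_def mat_mult_distribs)
  have \<phi>x: "\<phi> x = \<e> 2 1 + left_regular_mat a b c d"
    if "x ** x = a *\<^sub>m x + b *\<^sub>m y" "x ** y = c *\<^sub>m x + d *\<^sub>m y" for a b c d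
    by (rule \<phi>_eqI) (simp add: vec_eq_iff forall_3 mg gn that left_regular_mat_def
      matrix_vector_mult_add_rdistrib mult.commute)
  have \<phi>y: "\<phi> y = \<e> 3 1 + left_regular_mat a b c d"
    if "y ** x = a *\<^sub>m x + b *\<^sub>m y" "y ** y = c *\<^sub>m x + d *\<^sub>m y" for a b c d
    by (rule \<phi>_eqI) (simp add: vec_eq_iff forall_3 mg gn that left_regular_mat_def
      matrix_vector_mult_add_rdistrib mult.commute)
  \<comment> \<open>The first column of \<open>\<phi> m\<close> consists of the coordinates of \<open>m u\<close>.\<close>
  have col: "\<phi> m $ 1 $ 1 = k \<and> \<phi> m $ 2 $ 1 = s \<and> \<phi> m $ 3 $ 1 = t"
    if "m *v u = k *s u + s *s (x *v u) + t *s (y *v u)" for m k s t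
  proof -
    have e: "g *v (\<phi> m *v axis 1 1) = g *v vector [k, s, t]"
    proof -
      have "g *v (\<phi> m *v axis 1 1) = (m ** g) *v axis 1 1"
        by (simp add: g\<phi> matrix_vector_mul_assoc)
      also have "\<dots> = m *v u"
        by (simp add: vec_eq_iff mult_axis_nth mg)
      also have "\<dots> = g *v vector [k, s, t]"
        by (simp add: that vec_eq_iff matrix_vector_mult_def[of g] sum_3 g_nth mult.commute)
      finally show ?thesis .
    qed
    have "\<phi> m *v axis 1 1 = vector [k, s, t]"
      using arg_cong[OF e, of "\<lambda>v. g' *v v"] g'g by (simp add: matrix_vector_mul_assoc matrix_mul_assoc)
    then show ?thesis by (simp add: vec_eq_iff forall_3 mult_axis_nth)
  qed
  have "\<phi> ` B = parabolic"
  proof (intro equalityI subsetI)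
    fix n assume "n \<in> \<phi> ` B"
    then obtain b k where "n = \<phi> b" "b *v u = k *s u" using u(2) by blast
    then show "n \<in> parabolic" using col[of b k 0 0] by (simp add: mem_parabolic_iff)
  next
    fix n assume n: "n \<in> parabolic"
    obtain m where m: "n = \<phi> m" using auto unfolding automorphism_def by (metis bij_pointE)
    obtain s t b where b: "b \<in> B" and dm: "m = s *\<^sub>m x + t *\<^sub>m y + b" using dec by blast
    obtain k where k: "b *v u = k *s u" using u(2) b by blast
    have "m *v u = k *s u + s *s (x *v u) + t *s (y *v u)"
      by (simp add: dm matrix_vector_mult_add_rdistrib k)
    from col[OF this] have "s = 0" "t = 0" using n m by (simp_all add: mem_parabolic_iff)
    then have "m = b" using dm by simp
    then show "n \<in> \<phi> ` B" using m b by blast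
  qed
  moreover have "\<phi> ` A = cmat.span {\<phi> x, \<phi> y}"
  proof (rule set_eqI)
    fix n
    have "\<phi> (s *\<^sub>m x + t *\<^sub>m y) = s *\<^sub>m \<phi> x + t *\<^sub>m \<phi> y" for s t by (simp add: lin)
    then show "n \<in> \<phi> ` A \<longleftrightarrow> n \<in> cmat.span {\<phi> x, \<phi> y}"
      unfolding mem_span_pair image_iff Bex_def memA by metis
  qed
  ultimately show ?thesis by (intro exI[of _ \<phi>] conjI auto allI impI \<phi>x \<phi>y)
qed

section \<open>The normal forms\<close>

definition normal_form :: "(complex^3^3) set \<Rightarrow> bool" where
  "normal_form S \<longleftrightarrow>
    S = cmat.span {\<e> 2 1, \<e> 3 1} \<or>
    S = cmat.span {\<e> 2 1, \<e> 3 1 + \<e> 2 3} \<or>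
    S = cmat.span {\<e> 2 1 + \<e> 2 2, \<e> 3 1} \<or>
    S = cmat.span {\<e> 2 1 + \<e> 2 2 + \<e> 3 3, \<e> 3 1 + \<e> 3 2} \<or>
    S = cmat.span {\<e> 2 1 + \<e> 2 2 + \<e> 3 3, \<e> 3 1} \<or>
    S = cmat.span {\<e> 2 1 + \<e> 2 2, \<e> 3 1 + \<e> 3 2} \<or>
    S = cmat.span {\<e> 2 1 + \<e> 2 2, \<e> 3 1 + \<e> 3 3}"

lemma normal_form_of_invariant_line:
  fixes A B :: "(complex^3^3) set"
  assumes AB: "direct_sum_decomp A B" and xy: "plane_basis A x y" and std: "standard_plane_algebra x y"
    and u: "u \<noteq> 0" "\<forall>b\<in>B. \<exists>k. b *v u = k *s u"
  shows "\<exists>\<phi>. automorphism \<phi> \<and> \<phi> ` B = parabolic \<and> normal_form (\<phi> ` A)"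
proof -
  obtain \<phi> where \<phi>: "automorphism \<phi>" "\<phi> ` B = parabolic" and A: "\<phi> ` A = cmat.span {\<phi> x, \<phi> y}"
    and x: "\<forall>a b c d. x ** x = a *\<^sub>m x + b *\<^sub>m y \<longrightarrow> x ** y = c *\<^sub>m x + d *\<^sub>m y \<longrightarrow>
      \<phi> x = \<e> 2 1 + left_regular_mat a b c d"
    and y: "\<forall>a b c d. y ** x = a *\<^sub>m x + b *\<^sub>m y \<longrightarrow> y ** y = c *\<^sub>m x + d *\<^sub>m y \<longrightarrow>
      \<phi> y = \<e> 3 1 + left_regular_mat a b c d"
    using left_regular_normal_form[OF AB xy u] by blast
  note simps = A normal_form_def left_regular_mat_def products_def add.assoc
  from std have "normal_form (\<phi> ` A)"
    unfolding standard_plane_algebra_def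
  proof (elim disjE)
    assume "products x y 0 0 0 0"
    then show ?thesis using x[rule_format, of 0 0 0 0] y[rule_format, of 0 0 0 0] by (simp add: simps)
  next
    assume "products x y 0 0 0 x"
    then show ?thesis using x[rule_format, of 0 0 0 0] y[rule_format, of 0 0 1 0] by (simp add: simps)
  next
    assume "products x y x 0 0 0"
    then show ?thesis using x[rule_format, of 1 0 0 0] y[rule_format, of 0 0 0 0] by (simp add: simps)
  next
    assume "products x y x y y 0"
    then show ?thesis using x[rule_format, of 1 0 0 1] y[rule_format, of 0 1 0 0] by (simp add: simps)
  next
    assume "products x y x y 0 0"
    then show ?thesis using x[rule_format, of 1 0 0 1] y[rule_format, of 0 0 0 0] by (simp add: simps)
  next
    assume "products x y x 0 y 0"
    then show ?thesis using x[rule_format, of 1 0 0 0] y[rule_format, of 0 1 0 0] by (simp add: simps)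
  next
    assume "products x y x 0 0 y"
    then show ?thesis using x[rule_format, of 1 0 0 0] y[rule_format, of 0 0 0 1] by (simp add: simps)
  qed
  then show ?thesis using \<phi> by blast
qed

lemma normal_form_up_to_transpose:
  fixes A B :: "(complex^3^3) set"
  assumes A: "subalgebra A" "cmat.dim A = 2" and B: "subalgebra B" and AB: "direct_sum_decomp A B"
  shows "\<exists>\<phi>. (automorphism \<phi> \<or> antiautomorphism \<phi>) \<and> \<phi> ` B = parabolic \<and> normal_form (\<phi> ` A)"
proof -
  obtain x y where xy: "plane_basis A x y" and std: "standard_plane_algebra x y"
    using plane_algebra_classification[OF A] by blast
  from invariant_line_or_hyperplane[OF B AB xy]
  show ?thesis
  proof (elim disjE exE conjE)
    fix u assume "u \<noteq> 0" "\<forall>b\<in>B. \<exists>k. b *v u = k *s u"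
    from normal_form_of_invariant_line[OF AB xy std this] show ?thesis by blast
  next
    fix w assume w: "w \<noteq> 0" "\<forall>b\<in>B. \<exists>k. transpose b *v w = k *s w"
    \<comment> \<open>An invariant hyperplane of \<open>B\<close> is an invariant line of its transpose.\<close>
    have w': "\<forall>b\<in>transpose ` B. \<exists>k. b *v w = k *s w" using w(2) by blast
    obtain \<psi> where "automorphism \<psi>" "\<psi> ` transpose ` B = parabolic" "normal_form (\<psi> ` transpose ` A)"
      using normal_form_of_invariant_line[OF direct_sum_decomp_transpose[OF AB]
        plane_basis_transpose[OF xy] standard_plane_algebra_transpose[OF std] w(1) w'] by blast
    then show ?thesis
      by (intro exI[of _ "\<psi> \<circ> transpose"]) (auto simp: antiautomorphism_def image_comp)
  qed
qed

theorem theorem1: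
  fixes A B :: "(complex^3^3) set"
  assumes "subalgebra A" and "subalgebra B"
    and "direct_sum_decomp A B"
    and "cmat.dim A = 2" and "cmat.dim B = 7"
  shows "\<exists>\<phi> :: complex^3^3 \<Rightarrow> complex^3^3. (automorphism \<phi> \<or> antiautomorphism \<phi>) \<and>
    \<phi> ` B = cmat.span {\<e> 1 1, \<e> 1 2, \<e> 1 3, \<e> 2 2, \<e> 2 3, \<e> 3 2, \<e> 3 3} \<and>
    (\<phi> ` A = cmat.span {\<e> 2 1, \<e> 3 1} \<or>
     \<phi> ` A = cmat.span {\<e> 2 1, \<e> 3 1 + \<e> 2 3} \<or>
     \<phi> ` A = cmat.span {\<e> 2 1 + \<e> 2 2, \<e> 3 1} \<or>
     \<phi> ` A = cmat.span {\<e> 2 1 + \<e> 2 2 + \<e> 3 3, \<e> 3 1 + \<e> 3 2} \<or>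
     \<phi> ` A = cmat.span {\<e> 2 1 + \<e> 2 2 + \<e> 3 3, \<e> 3 1} \<or>
     \<phi> ` A = cmat.span {\<e> 2 1 + \<e> 2 2, \<e> 3 1 + \<e> 3 2} \<or>
     \<phi> ` A = cmat.span {\<e> 2 1 + \<e> 2 2, \<e> 3 1 + \<e> 3 3} \<or>
     (\<exists>y. y \<noteq> 0 \<and>
       \<phi> ` A = cmat.span {\<e> 2 1 + (1 - y) *\<^sub>m \<e> 2 2 + \<e> 2 3,
                          \<e> 3 1 + \<e> 2 2 + \<e> 2 3 + y *\<^sub>m \<e> 3 3}) \<or>
     (\<exists>y. y \<noteq> 0 \<and>
       \<phi> ` A = cmat.span {\<e> 2 1 + \<e> 2 2 + \<e> 3 3,
                          \<e> 3 1 + \<e> 3 2 + \<e> 2 3 + y *\<^sub>m \<e> 3 3}) \<or>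
     (\<exists>d f. f \<noteq> 0 \<and>
       \<phi> ` A = cmat.span {mat3 [0, 0, 0]
                               [1, d, 1]
                               [0, 1 / f, 1],
                          mat3 [0, 0, 0]
                               [0, 1, f]
                               [1, 1, 1 + f * (1 - d)]}))"
proof -
  obtain \<phi> where \<phi>: "automorphism \<phi> \<or> antiautomorphism \<phi>" "\<phi> ` B = parabolic"
    and nf: "normal_form (\<phi> ` A)"
    using normal_form_up_to_transpose[OF assms(1,4,2,3)] by blast
  show ?thesis
    by (intro exI[of _ \<phi>] conjI \<phi>(1) \<phi>(2)[unfolded parabolic_def])
      (use nf in \<open>unfold normal_form_def, elim disjE, simp_all only: simp_thms\<close>)
qed

end
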